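(* Let $d>0$, let $A(x)=\sum_{i=0}^d a_i x^i\in\mathbb{Z}[x]$ be a primitive polynomial of degree $d$ with $a_0\neq0$, and let $(\theta_i)_{i\ge1}$ be a sequence of real numbers with $\theta_1,\dots,\theta_d$ linearly independent over $\mathbb{Q}$ and $\sum_{i=0}^d a_i\theta_{j+i}=0$ for all $j\ge1$. Then for every $\epsilon<1/M(A(x))$ there exists $m_0$ such that for all $m\ge m_0$ the set $S_{\theta,m}=\{\pi_m(t\theta_1,\dots,t\theta_m): t\in\mathbb{R}\}\subseteq\mathbb{T}^m$ is not $\epsilon$-dense.
   Context: $\mathbb{T}^m=\mathbb{R}^m/\mathbb{Z}^m$, $\pi_m:\mathbb{R}^m\to\mathbb{T}^m$ is the canonical projection. For $\epsilon>0$ let $C_\epsilon=\pi_m([-\epsilon/2,\epsilon/2]^m)$. A set $S\subseteq\mathbb{T}^m$ is $\epsilon$-dense if $S+C_{\bar\epsilon}=\mathbb{T}^m$ for every $\bar\epsilon>\epsilon$. For $P(x)=c_d\prod_{i=1}^d(x-\alpha_i)\in\mathbb{C}[x]$ with $c_d\neq0$, the Mahler measure is $M(P)=|c_d|\prod_{i=1}^d\max\{1,|\alpha_i|\}$. *)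

theory Defs
  imports "Berlekamp_Zassenhaus.Mahler_Measure"
begin

text \<open>Points of the torus T^m = R^m / Z^m are represented by lifts x :: nat \<Rightarrow> real,
  using the coordinates 1..m. Two lifts represent the same point iff they differ
  coordinatewise by integers.\<close>

definition torus_eq :: "nat \<Rightarrow> (nat \<Rightarrow> real) \<Rightarrow> (nat \<Rightarrow> real) \<Rightarrow> bool" where
  "torus_eq m x y \<longleftrightarrow> (\<forall>i\<in>{1..m}. x i - y i \<in> \<int>)"

definition torus_cover :: "nat \<Rightarrow> (nat \<Rightarrow> real) set \<Rightarrow> real \<Rightarrow> bool" where
  "torus_cover m S e \<longleftrightarrow>
     (\<forall>y :: nat \<Rightarrow> real. \<exists>s\<in>S. \<exists>c :: nat \<Rightarrow> real.
        (\<forall>i\<in>{1..m}. - e / 2 \<le> c i \<and> c i \<le> e / 2) \<and> torus_eq m (\<lambda>i. s i + c i) y)"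

definition torus_eps_dense :: "nat \<Rightarrow> (nat \<Rightarrow> real) set \<Rightarrow> real \<Rightarrow> bool" where
  "torus_eps_dense m S e \<longleftrightarrow> (\<forall>e'>e. torus_cover m S e')"

definition line_lifts :: "(nat \<Rightarrow> real) \<Rightarrow> (nat \<Rightarrow> real) set" where
  "line_lifts \<theta> = {(\<lambda>i. t * \<theta> i) | t. True}"

end

theory Submission
  imports Defs
begin

text \<open>
  Since the recurrence kills the line, an \<open>\<epsilon>\<close>-dense line forces the image of the cube
  \<open>[-\<epsilon>/2, \<epsilon>/2]^m\<close> under the Toeplitz map \<open>L\<close> of \<open>A\<close> to cover \<open>R^n\<close> modulo \<open>Z^n\<close>, where
  \<open>n = m - d\<close>. It suffices that the volume of this image is at most a polynomial in \<open>n\<close> times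
  \<open>(\<epsilon> M(A))^n\<close>.

  Factor \<open>\<plusminus>A = P Q\<close> over the reals, \<open>Q\<close> monic with the roots in the closed unit disc and \<open>P\<close> with
  the other roots, so that \<open>P(0) = M(A)\<close>. Up to the \<open>deg Q\<close> initial coordinates of the input and the
  \<open>deg P\<close> final coordinates of the intermediate sequence, \<open>Q\<close> acts by a unipotent triangular matrix
  (solve forwards) and \<open>P\<close> by a triangular one with diagonal \<open>P(0)\<close> (solve backwards). By the location
  of the roots, both solutions depend on these boundary data with polynomial growth only, so that
  polynomially many choices of the boundary data suffice.

  In place of volumes, the points of \<open>(1/N) Z^n\<close> are counted: each integer vector in the image of the
  cube scaled by \<open>N\<close> is encoded by boundary data, cells of side \<open>D\<close> for the input, and rounding errors.
\<close>

subsection \<open>Polynomials acting on sequences\<close>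

text \<open>This is \<open>P(E) f\<close> at \<open>j\<close>, with \<open>E\<close> the shift
  operator. On a window of \<open>n\<close> outputs it is the Toeplitz map of \<open>P\<close>,
  which reads \<open>n + degree P\<close> inputs.\<close>

definition shift_apply :: "'a::comm_ring_1 poly \<Rightarrow> (nat \<Rightarrow> 'a) \<Rightarrow> nat \<Rightarrow> 'a" where
  "shift_apply P f j = (\<Sum>i\<le>degree P. coeff P i * f (j + i))"

lemma shift_apply_degree_le:
  assumes "degree P \<le> k"
  shows "shift_apply P f j = (\<Sum>i\<le>k. coeff P i * f (j + i))"
  unfolding shift_apply_def
  by (rule sum.mono_neutral_left) (use assms in \<open>auto simp: coeff_eq_0\<close>)

lemma shift_apply_0 [simp]: "shift_apply 0 f j = 0"
  by (simp add: shift_apply_def)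

lemma shift_apply_1 [simp]: "shift_apply 1 f j = f j"
  by (simp add: shift_apply_def)

lemma shift_apply_add: "shift_apply (P + Q) f j = shift_apply P f j + shift_apply Q f j"
proof -
  let ?k = "max (degree P) (degree Q)"
  have "shift_apply (P + Q) f j = (\<Sum>i\<le>?k. coeff (P + Q) i * f (j + i))"
    by (rule shift_apply_degree_le) (rule degree_add_le_max)
  moreover have "shift_apply P f j = (\<Sum>i\<le>?k. coeff P i * f (j + i))"
    by (rule shift_apply_degree_le) simp
  moreover have "shift_apply Q f j = (\<Sum>i\<le>?k. coeff Q i * f (j + i))"
    by (rule shift_apply_degree_le) simp
  ultimately show ?thesis
    by (simp add: algebra_simps sum.distrib)
qed

lemma shift_apply_smult: "shift_apply (smult a P) f j = a * shift_apply P f j"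
proof -
  have "shift_apply (smult a P) f j = (\<Sum>i\<le>degree P. coeff (smult a P) i * f (j + i))"
    by (rule shift_apply_degree_le) (rule degree_smult_le)
  then show ?thesis
    by (simp add: shift_apply_def sum_distrib_left mult.assoc)
qed

lemma shift_apply_pCons: "shift_apply (pCons a P) f j = a * f j + shift_apply P f (Suc j)"
proof -
  have "shift_apply (pCons a P) f j = (\<Sum>i\<le>Suc (degree P). coeff (pCons a P) i * f (j + i))"
    by (rule shift_apply_degree_le) (simp add: degree_pCons_le)
  then show ?thesis
    by (subst (asm) sum.atMost_Suc_shift) (simp add: shift_apply_def)
qed

text \<open>Polynomials in a single shift operator compose as they multiply, so a factorization
  splits the Toeplitz map into two stages with an intermediate sequence.\<close>

lemma shift_apply_mult: "shift_apply (P * Q) f j = shift_apply P (shift_apply Q f) j"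
  by (induction P arbitrary: j)
    (simp_all add: shift_apply_add shift_apply_smult shift_apply_pCons)

lemma shift_apply_seq_diff:
  "shift_apply P (\<lambda>i. f i - g i) j = shift_apply P f j - shift_apply P g j"
  by (simp add: shift_apply_def algebra_simps sum_subtractf)

lemma shift_apply_seq_scale: "shift_apply P (\<lambda>i. a * f i) j = a * shift_apply P f j"
  by (simp add: shift_apply_def sum_distrib_left mult_ac)

lemma shift_apply_cong:
  assumes "\<And>i. i \<le> degree P \<Longrightarrow> f (j + i) = g (j + i)"
  shows "shift_apply P f j = shift_apply P g j"
  unfolding shift_apply_def by (rule sum.cong) (use assms in auto)

lemma shift_apply_split_first:
  "shift_apply P f j = coeff P 0 * f j + (\<Sum>i\<in>{1..degree P}. coeff P i * f (j + i))"
proof -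
  have *: "{..degree P} = insert 0 {1..degree P}" by auto
  show ?thesis unfolding shift_apply_def * by (subst sum.insert) auto
qed

lemma shift_apply_split_last:
  "shift_apply P f j = (\<Sum>i<degree P. coeff P i * f (j + i)) + lead_coeff P * f (j + degree P)"
  unfolding shift_apply_def by (simp add: lessThan_Suc_atMost [symmetric])

lemma shift_apply_of_real:
  "shift_apply (map_poly complex_of_real P) (\<lambda>i. complex_of_real (f i)) j = of_real (shift_apply P f j)"
  by (simp add: shift_apply_def coeff_map_poly)

section \<open>Growth of solutions when the roots lie in the closed unit disc\<close>

definition coeff_norm :: "'a::{real_normed_field} poly \<Rightarrow> real" where
  "coeff_norm P = (\<Sum>i\<le>degree P. norm (coeff P i))"

lemma coeff_norm_nonneg: "coeff_norm P \<ge> 0"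
  by (simp add: coeff_norm_def sum_nonneg)

lemma norm_shift_apply_le:
  fixes P :: "'a::real_normed_field poly"
  assumes "\<And>i. i \<le> degree P \<Longrightarrow> norm (f (j + i)) \<le> X"
  shows "norm (shift_apply P f j) \<le> coeff_norm P * X"
proof -
  have "norm (shift_apply P f j) \<le> (\<Sum>i\<le>degree P. norm (coeff P i) * X)"
    unfolding shift_apply_def
    by (rule sum_norm_le) (use assms in \<open>auto simp: norm_mult intro!: mult_left_mono\<close>)
  then show ?thesis by (simp add: coeff_norm_def sum_distrib_right)
qed

text \<open>Stability of the recurrence solved forwards: perturbations of size \<open>X\<close> in
  the initial data and the right-hand side are amplified at most polynomially in \<open>n\<close>,
  with a constant depending on \<open>Q\<close> only. The type is general because the induction over
  the roots is complex and the application real.\<close>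

definition polynomial_growth :: "'a::real_normed_field poly \<Rightarrow> bool" where
  "polynomial_growth Q \<longleftrightarrow> (\<exists>C\<ge>0. \<forall>n e. \<forall>X\<ge>0. (\<forall>i<degree Q. norm (e i) \<le> X) \<longrightarrow>
     (\<forall>j<n. norm (shift_apply Q e j) \<le> X) \<longrightarrow>
     (\<forall>j<n + degree Q. norm (e j) \<le> C * (real n + 1) ^ degree Q * X))"

lemma degree_prod_linear_factors:
  "degree (\<Prod>a\<leftarrow>as. [:- a, 1:]) = length (as :: 'a::idom list)"
proof (induction as)
  case (Cons a as)
  have "(\<Prod>a\<leftarrow>as. [:- a, 1:]) \<noteq> 0" by (auto simp: prod_list_zero_iff)
  then have "degree ([:- a, 1:] * (\<Prod>a\<leftarrow>as. [:- a, 1:])) = Suc (length as)"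
    using Cons by (subst degree_mult_eq) simp_all
  then show ?case by simp
qed simp

text \<open>Split off one factor \<open>E - a\<close>. Then \<open>g = R(E) e\<close> obeys a
  first-order recurrence with multiplier of modulus at most 1, so it grows at most linearly, and the
  induction hypothesis for \<open>R\<close> passes from \<open>g\<close> to \<open>e\<close>. Each
  root costs one factor \<open>n + 1\<close>.\<close>

lemma polynomial_growth_prod:
  fixes as :: "complex list"
  assumes "\<forall>a\<in>set as. cmod a \<le> 1"
  shows "polynomial_growth (\<Prod>a\<leftarrow>as. [:- a, 1:])"
  using assms
proof (induction as)
  case Nil
  then show ?case
    by (auto simp: polynomial_growth_def intro!: exI[of _ 1])
next
  case (Cons a as)
  define R where "R = (\<Prod>a\<leftarrow>as. [:- a, 1:])"
  define k where "k = length as"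
  have degR: "degree R = k" unfolding R_def k_def by (rule degree_prod_linear_factors)
  have "polynomial_growth R" using Cons by (auto simp: R_def)
  then obtain C where C: "C \<ge> 0"
    and IH: "\<And>n e X j. X \<ge> 0 \<Longrightarrow> (\<forall>i<k. cmod (e i) \<le> X) \<Longrightarrow>
       (\<forall>j<n. cmod (shift_apply R e j) \<le> X) \<Longrightarrow> j < n + k \<Longrightarrow> cmod (e j) \<le> C * (real n + 1) ^ k * X"
    unfolding polynomial_growth_def degR by blast
  define S where "S = coeff_norm R"
  have S: "S \<ge> 0" by (simp add: S_def coeff_norm_nonneg)
  have bound: "cmod (e j) \<le> (C * 2 ^ k * (S + 1)) * (real n + 1) ^ Suc k * X"
    if X: "X \<ge> 0" and init: "\<forall>i<Suc k. cmod (e i) \<le> X"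
      and rec: "\<forall>j<n. cmod (shift_apply ([:- a, 1:] * R) e j) \<le> X" and j: "j < n + Suc k"
    for n e X j
  proof -
    define g where "g = shift_apply R e"
    have g_Suc: "g (Suc i) = a * g i + shift_apply ([:- a, 1:] * R) e i" for i
      by (subst shift_apply_mult) (simp add: shift_apply_pCons g_def)
    have g: "cmod (g i) \<le> (S + real i) * X" if "i \<le> n" for i
      using that
    proof (induction i)
      case 0
      have "cmod (g 0) \<le> coeff_norm R * X"
        unfolding g_def by (rule norm_shift_apply_le) (use init degR in auto)
      then show ?case by (simp add: S_def)
    next
      case (Suc i)
      have "cmod (a * g i) \<le> 1 * ((S + real i) * X)"
        unfolding norm_mult by (rule mult_mono) (use Suc Cons.prems in auto)
      moreover have "cmod (shift_apply ([:- a, 1:] * R) e i) \<le> X" using rec Suc by auto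
      ultimately have "cmod (g (Suc i)) \<le> 1 * ((S + real i) * X) + X"
        unfolding g_Suc by (rule norm_triangle_le[OF add_mono])
      then show ?case by (simp add: algebra_simps)
    qed
    \<comment> \<open>\<open>X'\<close> bounds \<open>g\<close> and the initial values of
      \<open>e\<close> at once, as the induction hypothesis wants a single bound.\<close>
    define X' where "X' = (S + 1) * (real n + 1) * X"
    have "1 * 1 \<le> (S + 1) * (real n + 1)" by (rule mult_mono) (use S in auto)
    then have XX': "X \<le> X'" using mult_right_mono[OF _ X, of 1] by (simp add: X'_def)
    have gX': "cmod (g i) \<le> X'" if "i < n + 1" for i
    proof -
      have "(S + real i) * X \<le> X'" unfolding X'_def
      proof (rule mult_right_mono[OF _ X])
        have "S + real i \<le> S + real n" using that by simp
        also have "\<dots> \<le> (S + 1) * (real n + 1)" using S by (simp add: algebra_simps)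
        finally show "S + real i \<le> (S + 1) * (real n + 1)" .
      qed
      then show ?thesis using g[of i] that by simp
    qed
    have "\<forall>i<k. cmod (e i) \<le> X'" using init XX' by (meson less_SucI order_trans)
    \<comment> \<open>\<open>R\<close> has degree one less, so its window has length
      \<open>n + 1\<close> to reach the same entries; the factor \<open>2 ^ k\<close> absorbs
      \<open>n + 2\<close> in place of \<open>n + 1\<close>.\<close>
    then have "cmod (e j) \<le> C * (real (n + 1) + 1) ^ k * X'"
      by (intro IH[of X' e "n + 1"]) (use X XX' gX' j in \<open>auto simp: g_def\<close>)
    also have "\<dots> \<le> C * (2 * (real n + 1)) ^ k * X'"
      by (intro mult_right_mono mult_left_mono power_mono) (use C X XX' in auto)
    also have "\<dots> = (C * 2 ^ k * (S + 1)) * (real n + 1) ^ Suc k * X"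
      unfolding X'_def power_mult_distrib by simp
    finally show ?thesis .
  qed
  have "(\<Prod>a\<leftarrow>a # as. [:- a, 1:]) = [:- a, 1:] * R" by (simp add: R_def)
  moreover have "degree ([:- a, 1:] * R) = Suc k"
    using degree_prod_linear_factors[of "a # as"] by (simp add: R_def k_def)
  moreover have "C * 2 ^ k * (S + 1) \<ge> 0" using C S by simp
  ultimately show ?case
    unfolding polynomial_growth_def using bound by (metis (no_types, lifting))
qed

lemma polynomial_growth_real:
  assumes "map_poly complex_of_real Q = (\<Prod>a\<leftarrow>as. [:- a, 1:])" "\<forall>a\<in>set as. cmod a \<le> 1"
  shows "polynomial_growth Q"
proof -
  let ?Q = "map_poly complex_of_real Q"
  have deg: "degree ?Q = degree Q" by (simp add: degree_map_poly)
  from polynomial_growth_prod[OF assms(2)] obtain C where C: "C \<ge> 0" and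
    bd: "\<And>n e X. X \<ge> 0 \<Longrightarrow> (\<forall>i<degree Q. cmod (e i) \<le> X) \<Longrightarrow>
       (\<forall>j<n. cmod (shift_apply ?Q e j) \<le> X) \<Longrightarrow>
       (\<forall>j<n + degree Q. cmod (e j) \<le> C * (real n + 1) ^ degree Q * X)"
    unfolding polynomial_growth_def assms(1)[symmetric] deg by blast
  show ?thesis unfolding polynomial_growth_def
  proof (intro exI[of _ C] conjI C allI impI)
    fix n e j and X :: real
    assume "X \<ge> 0" "\<forall>i<degree Q. norm (e i :: real) \<le> X"
      "\<forall>j<n. norm (shift_apply Q e j) \<le> X" "j < n + degree Q"
    then show "norm (e j) \<le> C * (real n + 1) ^ degree Q * X"
      using bd[of X "\<lambda>i. complex_of_real (e i)" n] by (simp add: shift_apply_of_real)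
  qed
qed

text \<open>Reading the window backwards turns \<open>P\<close> into its reflection, and division by
  \<open>coeff P 0\<close> makes that monic. Forward stability of the reflected recurrence is thus
  backward stability for \<open>P\<close>, with outputs measured in units of
  \<open>coeff P 0\<close>.\<close>

lemma polynomial_growth_backward:
  fixes P :: "real poly"
  assumes "polynomial_growth (smult (1 / coeff P 0) (reflect_poly P))" and P0: "coeff P 0 \<noteq> 0"
  shows "\<exists>C\<ge>0. \<forall>n f. \<forall>X\<ge>0. (\<forall>i<degree P. \<bar>f (n + i)\<bar> \<le> X) \<longrightarrow>
     (\<forall>j<n. \<bar>shift_apply P f j\<bar> \<le> \<bar>coeff P 0\<bar> * X) \<longrightarrow>
     (\<forall>j<n + degree P. \<bar>f j\<bar> \<le> C * (real n + 1) ^ degree P * X)"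
proof -
  let ?R = "smult (1 / coeff P 0) (reflect_poly P)"
  define p where "p = degree P"
  have deg: "degree ?R = p" using P0 by (simp add: p_def)
  have reflect: "shift_apply ?R (\<lambda>k. f (n + p - 1 - k)) j = shift_apply P f (n - 1 - j) / coeff P 0"
    if "j < n" for f n j
  proof -
    have "shift_apply (reflect_poly P) (\<lambda>k. f (n + p - 1 - k)) j =
        (\<Sum>i\<le>p. coeff P (p - i) * f (n + p - 1 - (j + i)))"
      unfolding shift_apply_def using P0 by (simp add: p_def coeff_reflect_poly)
    also have "\<dots> = (\<Sum>i\<le>p. coeff P i * f (n - 1 - j + i))"
      by (rule sum.reindex_bij_witness[of _ "\<lambda>i. p - i" "\<lambda>i. p - i"])
        (use that in \<open>auto intro!: arg_cong[of _ _ f]\<close>)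
    also have "\<dots> = shift_apply P f (n - 1 - j)" by (simp add: shift_apply_def p_def)
    finally show ?thesis by (simp add: shift_apply_smult)
  qed
  from assms(1) obtain C where C: "C \<ge> 0" and
    bd: "\<And>n e X. X \<ge> 0 \<Longrightarrow> (\<forall>i<p. \<bar>e i\<bar> \<le> X) \<Longrightarrow> (\<forall>j<n. \<bar>shift_apply ?R e j\<bar> \<le> X) \<Longrightarrow>
       (\<forall>j<n + p. \<bar>e j\<bar> \<le> C * (real n + 1) ^ p * X)"
    unfolding polynomial_growth_def deg real_norm_def by blast
  show ?thesis
  proof (intro exI[of _ C] conjI C allI impI, unfold p_def[symmetric])
    fix n f j and X :: real
    assume X: "X \<ge> 0" and fin: "\<forall>i<p. \<bar>f (n + i)\<bar> \<le> X"
      and rec: "\<forall>j<n. \<bar>shift_apply P f j\<bar> \<le> \<bar>coeff P 0\<bar> * X" and j: "j < n + p"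
    have 1: "\<forall>i<p. \<bar>f (n + p - 1 - i)\<bar> \<le> X"
    proof (intro allI impI)
      fix i assume "i < p"
      then show "\<bar>f (n + p - 1 - i)\<bar> \<le> X" using fin[rule_format, of "p - 1 - i"] by simp
    qed
    have 2: "\<forall>i<n. \<bar>shift_apply ?R (\<lambda>k. f (n + p - 1 - k)) i\<bar> \<le> X"
    proof (intro allI impI)
      fix i assume i: "i < n"
      have "\<bar>shift_apply P f (n - 1 - i)\<bar> \<le> \<bar>coeff P 0\<bar> * X" using rec i by auto
      then show "\<bar>shift_apply ?R (\<lambda>k. f (n + p - 1 - k)) i\<bar> \<le> X"
        unfolding reflect[OF i] using P0 by (simp add: divide_simps mult.commute)
    qed
    have "\<bar>f (n + p - 1 - (n + p - 1 - j))\<bar> \<le> C * (real n + 1) ^ p * X"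
      by (rule bd[OF X 1 2, rule_format]) (use j in simp)
    moreover have "n + p - 1 - (n + p - 1 - j) = j" using j by simp
    ultimately show "\<bar>f j\<bar> \<le> C * (real n + 1) ^ p * X" by metis
  qed
qed

subsection \<open>Splitting a polynomial along the unit circle\<close>

lemma map_poly_cnj_mult: "map_poly cnj (p * q) = map_poly cnj p * map_poly cnj q"
  by (rule poly_eqI) (simp add: coeff_map_poly coeff_mult cnj_sum)

lemma map_poly_cnj_linear_factors:
  "map_poly cnj (\<Prod>a\<leftarrow>as. [:- a, 1:]) = (\<Prod>a\<leftarrow>map cnj as. [:- a, 1:])"
proof (induction as)
  case (Cons a as)
  have "map_poly cnj [:- a, 1:] = [:- cnj a, 1:]" by (simp add: map_poly_pCons)
  then show ?case using Cons by (simp only: list.map prod_list.Cons map_poly_cnj_mult)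
qed simp

lemma linear_factors_cong_mset:
  fixes as bs :: "'a::comm_ring_1 list"
  assumes "mset as = mset bs"
  shows "(\<Prod>a\<leftarrow>as. [:- a, 1:]) = (\<Prod>a\<leftarrow>bs. [:- a, 1:])"
proof -
  have "mset (map (\<lambda>a. [:- a, 1:]) as) = mset (map (\<lambda>a. [:- a, 1:]) bs)"
    using assms by simp
  then show ?thesis by (metis prod_mset_prod_list)
qed

lemma real_poly_of_cnj_invariant:
  assumes "map_poly cnj p = p"
  obtains q where "map_poly complex_of_real q = p"
proof
  have "cnj (coeff p i) = coeff p i" for i
    using assms by (metis coeff_map_poly complex_cnj_zero)
  then have "coeff p i \<in> \<real>" for i by (simp add: Reals_cnj_iff)
  then show "map_poly complex_of_real (map_poly Re p) = p"
    by (intro poly_eqI) (simp add: coeff_map_poly of_real_Re)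
qed

lemma cnj_invariant_linear_factors:
  assumes "mset (map cnj as) = mset as"
  obtains q where "map_poly complex_of_real q = (\<Prod>a\<leftarrow>as. [:- a, 1:])"
proof -
  have "map_poly cnj (\<Prod>a\<leftarrow>as. [:- a, 1:]) = (\<Prod>a\<leftarrow>as. [:- a, 1:])"
    unfolding map_poly_cnj_linear_factors by (rule linear_factors_cong_mset[OF assms])
  then show ?thesis using that real_poly_of_cnj_invariant by blast
qed

lemma map_poly_of_real_mult:
  "map_poly complex_of_real (p * q) = map_poly complex_of_real p * map_poly complex_of_real q"
  by (rule poly_eqI) (simp add: coeff_map_poly coeff_mult)

lemma map_poly_of_real_inject:
  "map_poly complex_of_real p = map_poly complex_of_real q \<Longrightarrow> p = q"
  by (rule poly_eqI) (metis coeff_map_poly of_real_0 of_real_eq_iff)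

lemma reflect_linear_factors:
  fixes as :: "'a::field list"
  assumes "0 \<notin> set as"
  shows "reflect_poly (\<Prod>a\<leftarrow>as. [:- a, 1:]) =
     smult (\<Prod>a\<leftarrow>as. - a) (\<Prod>a\<leftarrow>map inverse as. [:- a, 1:])"
  using assms
proof (induction as)
  case (Cons a as)
  have "reflect_poly [:- a, 1:] = smult (- a) [:- inverse a, 1:]"
    using Cons.prems by (simp add: reflect_poly_pCons)
  then show ?case using Cons
    by (simp only: list.map prod_list.Cons reflect_poly_mult mult_smult_left mult_smult_right
        smult_smult) simp
qed simp

lemma coeff_0_linear_factors: "coeff (\<Prod>a\<leftarrow>as. [:- a, 1:]) 0 = (\<Prod>a\<leftarrow>as. - a :: 'a::idom)"
  by (induction as) (simp_all add: coeff_mult_0)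

text \<open>The roots of modulus at most 1 go to the monic \<open>Q\<close>, the others and the
  leading coefficient to \<open>P\<close>. Then \<open>coeff P 0\<close> is, up to sign, the leading
  coefficient times the product of the large roots, hence the Mahler measure in absolute value. The
  reflection of \<open>P\<close> has the inverses of the large roots, which lie in the disc. Both
  groups of roots are closed under conjugation, so the factors are real.\<close>

lemma mahler_factorization:
  fixes A :: "int poly"
  assumes "A \<noteq> 0"
  obtains P Q :: "real poly" where "map_poly real_of_int A = P * Q" "lead_coeff Q = 1"
    "polynomial_growth Q" "polynomial_growth (smult (1 / coeff P 0) (reflect_poly P))"
    "\<bar>coeff P 0\<bar> = mahler_measure A" "coeff P 0 \<noteq> 0"
proof -
  define rs where "rs = complex_roots_int A"
  define us where "us = filter (\<lambda>a. cmod a \<le> 1) rs"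
  define vs where "vs = filter (\<lambda>a. \<not> cmod a \<le> 1) rs"
  define l where "l = real_of_int (lead_coeff A)"
  have l: "l \<noteq> 0" using assms by (simp add: l_def)
  have lead: "lead_coeff (map_poly complex_of_int A) = of_real l"
    by (simp add: l_def)
  have fact: "smult (of_real l) (\<Prod>a\<leftarrow>rs. [:- a, 1:]) = map_poly complex_of_int A"
    using complex_roots_int(1)[of A] by (simp add: rs_def l_def)
  have cnj_smult: "map_poly cnj (smult (of_real l) p) = smult (of_real l) (map_poly cnj p)" for p
    by (rule poly_eqI) (simp add: coeff_map_poly)
  have "map_poly cnj (map_poly complex_of_int A) = map_poly complex_of_int A"
    by (rule poly_eqI) (simp add: coeff_map_poly)
  then have "smult (of_real l) (map_poly cnj (\<Prod>a\<leftarrow>rs. [:- a, 1:])) = smult (of_real l) (\<Prod>a\<leftarrow>rs. [:- a, 1:])"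
    unfolding fact[symmetric] cnj_smult .
  then have "(\<Prod>a\<leftarrow>map cnj rs. [:- a, 1:]) = (\<Prod>a\<leftarrow>rs. [:- a, 1:])"
    unfolding map_poly_cnj_linear_factors[symmetric]
    by (rule injD[OF smult_inj, rotated]) (use l in simp)
  \<comment> \<open>A product of monic linear factors determines the multiset of its roots,
    multiplicities included.\<close>
  then have cnj: "image_mset cnj (mset rs) = mset rs"
    using reconstruct_poly_monic_defines_mset by fastforce
  have cnj_filter: "mset (map cnj (filter R rs)) = mset (filter R rs)" if "\<And>a. R (cnj a) = R a" for R
  proof -
    have "mset (map cnj (filter R rs)) = filter_mset R (image_mset cnj (mset rs))"
      by (simp add: filter_mset_image_mset that)
    then show ?thesis by (simp add: cnj)
  qed
  obtain Q where Q: "map_poly complex_of_real Q = (\<Prod>a\<leftarrow>us. [:- a, 1:])"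
    using cnj_invariant_linear_factors[of us] cnj_filter unfolding us_def
    by (metis (no_types, lifting) complex_mod_cnj)
  obtain P0 where P0: "map_poly complex_of_real P0 = (\<Prod>a\<leftarrow>vs. [:- a, 1:])"
    using cnj_invariant_linear_factors[of vs] cnj_filter unfolding vs_def
    by (metis (no_types, lifting) complex_mod_cnj)
  define P where "P = smult l P0"
  have vs0: "0 \<notin> set vs" by (auto simp: vs_def)
  have "mset rs = mset (vs @ us)" by (simp add: us_def vs_def)
  then have "(\<Prod>a\<leftarrow>rs. [:- a, 1:]) = (\<Prod>a\<leftarrow>vs @ us. [:- a, 1:])"
    by (rule linear_factors_cong_mset)
  then have rs_eq: "(\<Prod>a\<leftarrow>rs. [:- a, 1:]) = (\<Prod>a\<leftarrow>vs. [:- a, 1:]) * (\<Prod>a\<leftarrow>us. [:- a, 1:])"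
    by simp
  have smult_of_real: "map_poly complex_of_real (smult c p) = smult (of_real c) (map_poly of_real p)"
    for c p by (rule poly_eqI) (simp add: coeff_map_poly)
  have AQ: "map_poly real_of_int A = P * Q"
  proof (rule map_poly_of_real_inject)
    have "map_poly complex_of_real (map_poly real_of_int A) = map_poly complex_of_int A"
      by (rule poly_eqI) (simp add: coeff_map_poly)
    also have "\<dots> = map_poly complex_of_real (P * Q)"
      unfolding map_poly_of_real_mult P_def smult_of_real P0 Q fact[symmetric] rs_eq by simp
    finally show "map_poly complex_of_real (map_poly real_of_int A) = map_poly of_real (P * Q)" .
  qed
  have monic: "lead_coeff (\<Prod>a\<leftarrow>as. [:- a, 1:]) = 1" for as :: "complex list"
    by (induction as) (simp_all only: list.map prod_list.Cons lead_coeff_mult, simp_all)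
  have "complex_of_real (lead_coeff Q) = lead_coeff (map_poly complex_of_real Q)"
    by (simp add: degree_map_poly coeff_map_poly)
  then have leadQ: "lead_coeff Q = 1" unfolding Q monic by simp
  have growQ: "polynomial_growth Q"
    by (rule polynomial_growth_real[OF Q]) (auto simp: us_def)
  have P0_0: "complex_of_real (coeff P0 0) = (\<Prod>a\<leftarrow>vs. - a)"
    using arg_cong[OF P0, of "\<lambda>p. coeff p 0"] unfolding coeff_0_linear_factors
    by (simp add: coeff_map_poly)
  have "(\<Prod>a\<leftarrow>vs. - a) \<noteq> 0" using vs0 by (auto simp: prod_list_zero_iff)
  then have P0n: "coeff P0 0 \<noteq> 0" using P0_0 by auto
  have "map_poly complex_of_real (reflect_poly P0) = reflect_poly (\<Prod>a\<leftarrow>vs. [:- a, 1:])"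
    unfolding P0[symmetric]
    by (rule poly_eqI) (simp add: coeff_map_poly coeff_reflect_poly degree_map_poly)
  then have refl: "map_poly complex_of_real (smult (1 / coeff P 0) (reflect_poly P)) =
      (\<Prod>a\<leftarrow>map inverse vs. [:- a, 1:])"
    unfolding P_def reflect_poly_smult smult_of_real reflect_linear_factors[OF vs0] P0_0[symmetric]
    using l P0n by simp
  have growP: "polynomial_growth (smult (1 / coeff P 0) (reflect_poly P))"
    by (rule polynomial_growth_real[OF refl])
      (auto simp: vs_def norm_inverse intro!: inverse_le_1_iff[THEN iffD2])
  have norm_prod: "cmod (\<Prod>a\<leftarrow>as. - a) = (\<Prod>a\<leftarrow>as. cmod a)" for as
    by (induction as) (simp_all add: norm_mult)
  have "\<bar>coeff P0 0\<bar> = cmod (\<Prod>a\<leftarrow>vs. - a)" by (simp flip: P0_0)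
  \<comment> \<open>Roots in the disc contribute the factor 1, so the product extends from
    \<open>vs\<close> to \<open>rs\<close>.\<close>
  also have "\<dots> = (\<Prod>a\<leftarrow>rs. max 1 (cmod a))"
    unfolding norm_prod vs_def by (induction rs) (auto simp: max_def)
  finally have "\<bar>coeff P 0\<bar> = mahler_measure A"
    unfolding mahler_measure_def mahler_measure_poly_def lead
    by (simp add: P_def abs_mult rs_def complex_roots_int_def)
  moreover have "coeff P 0 \<noteq> 0" using l P0n by (simp add: P_def)
  ultimately show ?thesis using that[OF AQ leadQ growQ growP] by blast
qed

subsection \<open>Counting integer outputs\<close>

text \<open>The leading coefficient is nonzero, so each equation is solved for its last entry.
  Applied to \<open>Q\<close> it continues prescribed initial data; applied to \<open>P * Q\<close>
  it shows that the Toeplitz map is onto.\<close>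

lemma forward_solution_exists:
  fixes Q :: "'a::field poly"
  assumes "Q \<noteq> 0"
  shows "\<exists>f. (\<forall>i<degree Q. f i = s i) \<and> (\<forall>j<n. shift_apply Q f j = h j)"
proof (induction n)
  case 0
  show ?case by (rule exI[of _ s]) simp
next
  case (Suc n)
  let ?q = "degree Q"
  from Suc obtain f where f: "\<forall>i<?q. f i = s i" "\<forall>j<n. shift_apply Q f j = h j" by blast
  define v where "v = (h n - (\<Sum>i<?q. coeff Q i * f (n + i))) / lead_coeff Q"
  define f' where "f' = f(n + ?q := v)"
  have "shift_apply Q f' n = (\<Sum>i<?q. coeff Q i * f' (n + i)) + lead_coeff Q * f' (n + ?q)"
    by (rule shift_apply_split_last)
  also have "(\<Sum>i<?q. coeff Q i * f' (n + i)) = (\<Sum>i<?q. coeff Q i * f (n + i))"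
    by (rule sum.cong) (auto simp: f'_def)
  finally have "shift_apply Q f' n = (\<Sum>i<?q. coeff Q i * f (n + i)) + lead_coeff Q * f' (n + ?q)" .
  moreover have "f' (n + ?q) = v" by (simp add: f'_def)
  ultimately have "shift_apply Q f' n = h n" using assms by (simp add: v_def)
  moreover have "shift_apply Q f' j = shift_apply Q f j" if "j < n" for j
    by (rule shift_apply_cong) (use that in \<open>auto simp: f'_def\<close>)
  ultimately have "\<forall>j<Suc n. shift_apply Q f' j = h j" using f(2) by (auto simp: less_Suc_eq)
  moreover have "\<forall>i<?q. f' i = s i" using f(1) by (auto simp: f'_def)
  ultimately show ?case by blast
qed

section \<open>Rounding to a lattice and encoding\<close>

lemma floor_lattice_bounds:
  assumes "D > (0::real)"
  shows "D * of_int \<lfloor>x / D\<rfloor> \<le> x" "x \<le> D * of_int \<lfloor>x / D\<rfloor> + D"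
proof -
  define k where "k = real_of_int \<lfloor>x / D\<rfloor>"
  have "k \<le> x / D" "x / D \<le> k + 1" unfolding k_def by linarith+
  then show "D * of_int \<lfloor>x / D\<rfloor> \<le> x" "x \<le> D * of_int \<lfloor>x / D\<rfloor> + D"
    unfolding k_def[symmetric] using assms by (simp_all add: field_simps)
qed

lemma floor_diff_bound:
  assumes "D > (0::real)"
  shows "\<bar>D * of_int \<lfloor>x / D\<rfloor> - x\<bar> \<le> D"
  using floor_lattice_bounds[OF assms, of x] by linarith

text \<open>The equations are solved from the last index down, each for its first entry, which is
  rounded down to a multiple of \<open>D\<close> at once. Later equations already use rounded
  entries, so output errors do not accumulate: each is \<open>coeff P 0\<close> times a single
  rounding error.\<close>

lemma backward_rounding_exists:
  fixes P :: "real poly"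
  assumes p0: "coeff P 0 > 0" and D: "D > 0"
  shows "\<exists>g. (\<forall>i\<ge>n. g i = t i) \<and> (\<forall>j<n. (\<exists>k::int. g j = D * of_int k) \<and>
     0 \<le> w j - shift_apply P g j \<and> w j - shift_apply P g j \<le> coeff P 0 * D)"
proof -
  let ?ok = "\<lambda>g j. (\<exists>k::int. g j = D * of_int k) \<and>
     0 \<le> w j - shift_apply P g j \<and> w j - shift_apply P g j \<le> coeff P 0 * D"
  \<comment> \<open>\<open>m\<close> counts the positions treated so far, from \<open>n - 1\<close>
    downwards.\<close>
  have "\<exists>g. (\<forall>i\<ge>n. g i = t i) \<and> (\<forall>j<n. n \<le> j + m \<longrightarrow> ?ok g j)" for m
  proof (induction m)
    case 0
    show ?case by (rule exI[of _ t]) auto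
  next
    case (Suc m)
    then obtain g where g: "\<forall>i\<ge>n. g i = t i" "\<forall>j<n. n \<le> j + m \<longrightarrow> ?ok g j" by blast
    show ?case
    proof (cases "Suc m \<le> n")
      case False
      then show ?thesis using g by (intro exI[of _ g]) auto
    next
      case True
      define j0 where "j0 = n - Suc m"
      define x where "x = (w j0 - (\<Sum>i\<in>{1..degree P}. coeff P i * g (j0 + i))) / coeff P 0"
      define v where "v = D * of_int \<lfloor>x / D\<rfloor>"
      define g' where "g' = g(j0 := v)"
      have "shift_apply P g' j0 = coeff P 0 * g' j0 + (\<Sum>i\<in>{1..degree P}. coeff P i * g' (j0 + i))"
        by (rule shift_apply_split_first)
      also have "(\<Sum>i\<in>{1..degree P}. coeff P i * g' (j0 + i)) =
          (\<Sum>i\<in>{1..degree P}. coeff P i * g (j0 + i))"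
        by (rule sum.cong) (auto simp: g'_def)
      moreover have "g' j0 = v" by (simp add: g'_def)
      ultimately have eq: "w j0 - shift_apply P g' j0 = coeff P 0 * (x - v)"
        using p0 by (simp add: x_def field_simps)
      have "0 \<le> x - v" "x - v \<le> D" using floor_lattice_bounds[OF D, of x] by (simp_all add: v_def)
      then have "?ok g' j0" unfolding eq using p0
        by (auto simp: g'_def v_def intro!: mult_left_mono)
      moreover have "?ok g' j" if "j < n" "n \<le> j + m" for j
      proof -
        have "j > j0" using that True by (simp add: j0_def)
        then have "shift_apply P g' j = shift_apply P g j" "g' j = g j"
          by (auto simp: g'_def intro!: shift_apply_cong)
        then show ?thesis using g(2) that by auto
      qed
      moreover have "j = j0 \<or> n \<le> j + m" if "n \<le> j + Suc m" for j
        using that True by (auto simp: j0_def)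
      ultimately have "\<forall>j<n. n \<le> j + Suc m \<longrightarrow> ?ok g' j" by metis
      moreover have "\<forall>i\<ge>n. g' i = t i" using g(1) True by (auto simp: g'_def j0_def)
      ultimately show ?thesis by blast
    qed
  qed
  from this[of n] show ?thesis by auto
qed

lemma card_floor_range_le:
  assumes "D > 0" "x \<ge> 0"
  shows "real (card {\<lfloor>- x / D\<rfloor>..\<lfloor>x / D\<rfloor>}) \<le> 2 * x / D + 2"
proof -
  have "- x / D \<le> x / D" using assms by (simp add: divide_right_mono)
  then have "\<lfloor>- x / D\<rfloor> \<le> \<lfloor>x / D\<rfloor>" by (rule floor_mono)
  then have "real (card {\<lfloor>- x / D\<rfloor>..\<lfloor>x / D\<rfloor>}) = of_int (\<lfloor>x / D\<rfloor> - \<lfloor>- x / D\<rfloor> + 1)"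
    by simp
  also have "\<dots> \<le> x / D - (- x / D - 1) + 1"
    unfolding of_int_add of_int_diff of_int_1 by linarith
  finally show ?thesis by simp
qed

lemma floor_in_range:
  assumes "D > 0" "\<bar>y\<bar> \<le> x"
  shows "\<lfloor>y / D\<rfloor> \<in> {\<lfloor>- x / D\<rfloor>..\<lfloor>x / D\<rfloor>}"
proof -
  have "- x / D \<le> y / D" "y / D \<le> x / D"
    using assms by (intro divide_right_mono; linarith)+
  then show ?thesis by (auto intro!: floor_mono)
qed

text \<open>Both numbers lie in the same coset of the multiples of \<open>D\<close>, and a half-open
  cell of side \<open>D\<close> holds only one point of a coset.\<close>

lemma eq_of_floor_eq_lattice:
  fixes x y :: real and k l :: int
  assumes D: "D > 0" and "\<lfloor>x / D\<rfloor> = \<lfloor>y / D\<rfloor>" "r + x = D * of_int k" "r + y = D * of_int l"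
  shows "x = y"
proof -
  have "x / D = of_int k - r / D" "y / D = of_int l - r / D"
    using assms by (simp_all add: field_simps)
  moreover have "\<bar>x / D - y / D\<bar> < 1" using assms(2) by linarith
  ultimately have "k = l" by linarith
  then show ?thesis using assms by simp
qed

lemma restrict_eqD: "restrict f A = restrict g A \<Longrightarrow> x \<in> A \<Longrightarrow> f x = g x"
  by (metis restrict_apply')

text \<open>The first two factors count boundary data, whose number does not depend on
  \<open>n\<close>. The last two count, per coordinate, cells and rounding errors; their product is
  close to \<open>2 * K * coeff P 0\<close> once \<open>D\<close> is large and \<open>K / D\<close>
  is large compared with \<open>G\<close>. The hypothesis \<open>growth\<close> collects all that is
  used about the location of the roots.\<close>

lemma card_integer_outputs_le:
  fixes P Q :: "real poly" and c :: "'u \<Rightarrow> nat \<Rightarrow> real" and w :: "'u \<Rightarrow> nat \<Rightarrow> int"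
  defines "p \<equiv> degree P" and "q \<equiv> degree Q"
  assumes leadQ: "lead_coeff Q = 1" and p0: "coeff P 0 > 0" and D: "D > 0" and K: "K > 0"
    and G: "G \<ge> 0"
    and c: "\<And>u i. u \<in> U \<Longrightarrow> i < n + p + q \<Longrightarrow> \<bar>c u i\<bar> \<le> K"
    and w: "\<And>u j. u \<in> U \<Longrightarrow> j < n \<Longrightarrow> of_int (w u j) = shift_apply (P * Q) (c u) j"
    and inj: "\<And>u v. u \<in> U \<Longrightarrow> v \<in> U \<Longrightarrow> (\<And>j. j < n \<Longrightarrow> w u j = w v j) \<Longrightarrow> u = v"
    and growth: "\<And>e f j. (\<And>i. i < q \<Longrightarrow> \<bar>e i\<bar> \<le> D) \<Longrightarrow> (\<And>i. i < p \<Longrightarrow> \<bar>f (n + i)\<bar> \<le> D) \<Longrightarrow>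
       (\<And>j. j < n \<Longrightarrow> \<bar>shift_apply P f j\<bar> \<le> coeff P 0 * D) \<Longrightarrow>
       (\<And>j. j < n \<Longrightarrow> shift_apply Q e j = f j) \<Longrightarrow> j < n + q \<Longrightarrow> \<bar>e j\<bar> \<le> G * D"
  shows "real (card U) \<le> (2 * K / D + 2) ^ q * (2 * (coeff_norm Q * K) / D + 2) ^ p *
     (2 * (K + G * D) / D + 2) ^ n * (coeff P 0 * D + 1) ^ n"
proof -
  define b where "b u = shift_apply Q (c u)" for u
  have w_b: "of_int (w u j) = shift_apply P (b u) j" if "u \<in> U" "j < n" for u j
    using w[OF that] by (simp add: shift_apply_mult b_def[abs_def])
  have "Q \<noteq> 0" using leadQ by auto
  have "\<exists>g. (\<forall>i\<ge>n. g i = D * of_int \<lfloor>b u i / D\<rfloor>) \<and> (\<forall>j<n. (\<exists>k::int. g j = D * of_int k) \<and>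
     0 \<le> of_int (w u j) - shift_apply P g j \<and> of_int (w u j) - shift_apply P g j \<le> coeff P 0 * D)" for u
    by (rule backward_rounding_exists[OF p0 D])
  then obtain g where g_end: "\<And>u i. i \<ge> n \<Longrightarrow> g u i = D * of_int \<lfloor>b u i / D\<rfloor>"
    and g_lattice: "\<And>u j. j < n \<Longrightarrow> \<exists>k::int. g u j = D * of_int k"
    and g_lower: "\<And>u j. j < n \<Longrightarrow> 0 \<le> of_int (w u j) - shift_apply P (g u) j"
    and g_upper: "\<And>u j. j < n \<Longrightarrow> of_int (w u j) - shift_apply P (g u) j \<le> coeff P 0 * D"
    by metis
  have "\<exists>f. (\<forall>i<q. f i = D * of_int \<lfloor>c u i / D\<rfloor>) \<and> (\<forall>j<n. shift_apply Q f j = g u j)" for u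
    unfolding q_def by (rule forward_solution_exists[OF \<open>Q \<noteq> 0\<close>])
  then obtain f where f_init: "\<And>u i. i < q \<Longrightarrow> f u i = D * of_int \<lfloor>c u i / D\<rfloor>"
    and f_rec: "\<And>u j. j < n \<Longrightarrow> shift_apply Q (f u) j = g u j"
    by metis
  have f_bound: "\<bar>f u j\<bar> \<le> K + G * D" if u: "u \<in> U" and j: "j < n + q" for u j
  proof -
    \<comment> \<open>The differences \<open>f - c\<close> and \<open>g - b\<close> fit
      \<open>growth\<close>: their boundary values are rounding errors, and the output error is
      controlled because \<open>P\<close> maps \<open>b u\<close> exactly to
      \<open>w u\<close>.\<close>
    have "\<bar>f u j - c u j\<bar> \<le> G * D"
    proof (rule growth[of "\<lambda>i. f u i - c u i" "\<lambda>i. g u i - b u i"])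
      show "\<bar>f u i - c u i\<bar> \<le> D" if "i < q" for i
        unfolding f_init[OF that] by (rule floor_diff_bound[OF D])
      show "\<bar>g u (n + i) - b u (n + i)\<bar> \<le> D" for i
        by (simp add: g_end floor_diff_bound[OF D])
      show "\<bar>shift_apply P (\<lambda>i. g u i - b u i) j\<bar> \<le> coeff P 0 * D" if "j < n" for j
        unfolding shift_apply_seq_diff w_b[OF u that, symmetric]
        using g_lower[OF that] g_upper[OF that] by (simp add: abs_le_iff)
      show "shift_apply Q (\<lambda>i. f u i - c u i) j = g u j - b u j" if "j < n" for j
        unfolding shift_apply_seq_diff f_rec[OF that] by (simp add: b_def)
    qed (rule j)
    moreover have "\<bar>c u j\<bar> \<le> K" using c[OF u, of j] j by simp
    ultimately show ?thesis by linarith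
  qed
  have b_bound: "\<bar>b u (n + i)\<bar> \<le> coeff_norm Q * K" if "u \<in> U" "i < p" for u i
    using norm_shift_apply_le[of Q "c u" "n + i" K] c[OF that(1)] that(2) by (simp add: b_def q_def)
  \<comment> \<open>The code of \<open>u\<close>: boundary data of the input and of the intermediate sequence; the cells of
    the reconstructed input; the position of \<open>w u j\<close> relative to the reconstructed output. The cell
    of \<open>f u (j + q)\<close> determines it, as \<open>g u j\<close> lies in the lattice \<open>D \<int>\<close> and earlier terms are known.\<close>
  define Z where "Z x = {\<lfloor>- x / D\<rfloor>..\<lfloor>x / D\<rfloor>}" for x
  define code where "code u = (restrict (\<lambda>i. \<lfloor>c u i / D\<rfloor>) {..<q}, restrict (\<lambda>i. \<lfloor>b u (n + i) / D\<rfloor>) {..<p},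
     restrict (\<lambda>j. \<lfloor>f u (j + q) / D\<rfloor>) {..<n},
     restrict (\<lambda>j. \<lfloor>of_int (w u j) - shift_apply P (g u) j\<rfloor>) {..<n})" for u
  define T where "T = PiE {..<q} (\<lambda>_. Z K) \<times> PiE {..<p} (\<lambda>_. Z (coeff_norm Q * K)) \<times>
    PiE {..<n} (\<lambda>_. Z (K + G * D)) \<times> PiE {..<n} (\<lambda>_. {0..\<lfloor>coeff P 0 * D\<rfloor>})"
  have "finite T" unfolding T_def Z_def by (intro finite_cartesian_product finite_PiE) auto
  have code_T: "code u \<in> T" if "u \<in> U" for u
    unfolding code_def T_def Z_def mem_Times_iff fst_conv snd_conv
    by (intro conjI restrict_PiE_iff[THEN iffD2] ballI floor_in_range[OF D])
      (use that c b_bound f_bound g_lower g_upper in \<open>auto intro: floor_mono\<close>)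
  have "inj_on code U"
  proof (rule inj_onI)
    fix u v assume u: "u \<in> U" and v: "v \<in> U" and eq: "code u = code v"
    note codes = eq[unfolded code_def prod.inject, THEN conjunct1]
      eq[unfolded code_def prod.inject, THEN conjunct2, THEN conjunct1]
      eq[unfolded code_def prod.inject, THEN conjunct2, THEN conjunct2, THEN conjunct1]
      eq[unfolded code_def prod.inject, THEN conjunct2, THEN conjunct2, THEN conjunct2]
    have eq1: "\<lfloor>c u i / D\<rfloor> = \<lfloor>c v i / D\<rfloor>" if "i < q" for i
      by (rule restrict_eqD[OF codes(1)]) (use that in simp)
    have eq2: "\<lfloor>b u (n + i) / D\<rfloor> = \<lfloor>b v (n + i) / D\<rfloor>" if "i < p" for i
      by (rule restrict_eqD[OF codes(2)]) (use that in simp)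
    have eq3: "\<lfloor>f u (j + q) / D\<rfloor> = \<lfloor>f v (j + q) / D\<rfloor>" if "j < n" for j
      by (rule restrict_eqD[OF codes(3)]) (use that in simp)
    have eq4: "\<lfloor>of_int (w u j) - shift_apply P (g u) j\<rfloor> = \<lfloor>of_int (w v j) - shift_apply P (g v) j\<rfloor>" if "j < n" for j
      by (rule restrict_eqD[OF codes(4)]) (use that in simp)
    have f_eq: "f u i = f v i" if "i < n + q" for i
      using that
    proof (induction i rule: less_induct)
      case (less i)
      show ?case
      proof (cases "i < q")
        case True
        then show ?thesis by (simp add: f_init eq1)
      next
        case False
        define j where "j = i - q"
        have j: "j < n" "i = j + q" using less.prems False by (auto simp: j_def)
        define r where "r = (\<Sum>k<q. coeff Q k * f u (j + k))"
        have r_v: "r = (\<Sum>k<q. coeff Q k * f v (j + k))"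
          unfolding r_def by (rule sum.cong) (use less j in auto)
        have "r + f u (j + q) = g u j"
          using f_rec[OF j(1), of u] leadQ unfolding r_def shift_apply_split_last q_def by simp
        moreover have "r + f v (j + q) = g v j"
          using f_rec[OF j(1), of v] leadQ unfolding r_v shift_apply_split_last q_def by simp
        ultimately obtain k l :: int where "r + f u (j + q) = D * of_int k" "r + f v (j + q) = D * of_int l"
          using g_lattice[OF j(1)] by metis
        then show ?thesis unfolding j(2) by (rule eq_of_floor_eq_lattice[OF D eq3[OF j(1)]])
      qed
    qed
    \<comment> \<open>Below \<open>n\<close> the values of \<open>g\<close> are recovered from
      \<open>f\<close> through \<open>Q\<close>; from \<open>n\<close> on they are the recorded
      boundary cells.\<close>
    have g_eq: "g u i = g v i" if "i < n + p" for i
    proof (cases "i < n")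
      case True
      have "shift_apply Q (f u) i = shift_apply Q (f v) i"
        by (rule shift_apply_cong) (use True f_eq in \<open>auto simp: q_def\<close>)
      then show ?thesis using f_rec[OF True] by simp
    next
      case False
      then show ?thesis using eq2[of "i - n"] that by (simp add: g_end)
    qed
    show "u = v"
    proof (rule inj[OF u v])
      fix j assume j: "j < n"
      have "shift_apply P (g u) j = shift_apply P (g v) j"
        by (rule shift_apply_cong) (use j g_eq in \<open>auto simp: p_def\<close>)
      \<comment> \<open>Both integers have the same floor of their distance from a common
        value.\<close>
      then have "\<bar>real_of_int (w u j) - of_int (w v j)\<bar> < 1" using eq4[OF j] by linarith
      then show "w u j = w v j" by linarith
    qed
  qed
  then have "card U = card (code ` U)" by (simp add: card_image)
  also have "\<dots> \<le> card T" by (rule card_mono[OF \<open>finite T\<close>]) (use code_T in auto)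
  finally have "real (card U) \<le> real (card T)" by simp
  also have "\<dots> = real (card (Z K)) ^ q * real (card (Z (coeff_norm Q * K))) ^ p *
      real (card (Z (K + G * D))) ^ n * real (card {0..\<lfloor>coeff P 0 * D\<rfloor>}) ^ n"
    unfolding T_def card_cartesian_product by (simp add: card_PiE)
  also have "\<dots> \<le> (2 * K / D + 2) ^ q * (2 * (coeff_norm Q * K) / D + 2) ^ p *
     (2 * (K + G * D) / D + 2) ^ n * (coeff P 0 * D + 1) ^ n"
  proof -
    have Z: "real (card (Z x)) \<le> 2 * x / D + 2" if "x \<ge> 0" for x
      unfolding Z_def by (rule card_floor_range_le[OF D that])
    have nonneg: "0 \<le> coeff_norm Q * K" "0 \<le> K + G * D"
      using K G D coeff_norm_nonneg[of Q] by simp_all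
    have pos: "2 * x / D + 2 \<ge> 0" if "x \<ge> 0" for x using that D by simp
    have "0 \<le> coeff P 0 * D" using p0 D by simp
    then have "real (card {0..\<lfloor>coeff P 0 * D\<rfloor>}) \<le> coeff P 0 * D + 1"
      by simp
    then show ?thesis
      using Z Z[OF nonneg(2)] pos pos[OF nonneg(2)] nonneg K D p0
      by (intro mult_mono power_mono mult_nonneg_nonneg zero_le_power) simp_all
  qed
  finally show ?thesis .
qed

text \<open>Backward stability for \<open>P\<close> bounds the intermediate error \<open>f\<close>,
  then forward stability for \<open>Q\<close> bounds \<open>e\<close>. The constant is independent
  of \<open>n\<close> and \<open>D\<close>.\<close>

lemma combined_growth:
  fixes P Q :: "real poly"
  assumes gQ: "polynomial_growth Q" and gP: "polynomial_growth (smult (1 / coeff P 0) (reflect_poly P))"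
    and p0: "coeff P 0 > 0"
  obtains C where "C \<ge> 0" "\<And>n D e f j. D > 0 \<Longrightarrow> (\<And>i. i < degree Q \<Longrightarrow> \<bar>e i\<bar> \<le> D) \<Longrightarrow>
       (\<And>i. i < degree P \<Longrightarrow> \<bar>f (n + i)\<bar> \<le> D) \<Longrightarrow>
       (\<And>j. j < n \<Longrightarrow> \<bar>shift_apply P f j\<bar> \<le> coeff P 0 * D) \<Longrightarrow>
       (\<And>j. j < n \<Longrightarrow> shift_apply Q e j = f j) \<Longrightarrow> j < n + degree Q \<Longrightarrow>
       \<bar>e j\<bar> \<le> (C * (real n + 1) ^ (degree P + degree Q)) * D"
proof -
  define p where "p = degree P"
  define q where "q = degree Q"
  from gQ obtain C1 where C1: "C1 \<ge> 0" and
    b1: "\<And>n e X. X \<ge> 0 \<Longrightarrow> (\<forall>i<q. \<bar>e i\<bar> \<le> X) \<Longrightarrow> (\<forall>j<n. \<bar>shift_apply Q e j\<bar> \<le> X) \<Longrightarrow>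
       (\<forall>j<n + q. \<bar>e j\<bar> \<le> C1 * (real n + 1) ^ q * X)"
    unfolding polynomial_growth_def q_def real_norm_def by blast
  from polynomial_growth_backward[OF gP] p0 obtain C2 where C2: "C2 \<ge> 0" and
    b2: "\<And>n f X. X \<ge> 0 \<Longrightarrow> (\<forall>i<p. \<bar>f (n + i)\<bar> \<le> X) \<Longrightarrow> (\<forall>j<n. \<bar>shift_apply P f j\<bar> \<le> \<bar>coeff P 0\<bar> * X) \<Longrightarrow>
       (\<forall>j<n + p. \<bar>f j\<bar> \<le> C2 * (real n + 1) ^ p * X)"
    unfolding p_def by (metis less_irrefl)
  show ?thesis
  proof (rule that[of "C1 * (C2 + 1)", folded p_def q_def])
    show "C1 * (C2 + 1) \<ge> 0" using C1 C2 by simp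
    fix n j D and e f :: "nat \<Rightarrow> real"
    assume D: "D > 0" and e: "\<And>i. i < q \<Longrightarrow> \<bar>e i\<bar> \<le> D"
      and f: "\<And>i. i < p \<Longrightarrow> \<bar>f (n + i)\<bar> \<le> D"
      and Pf: "\<And>j. j < n \<Longrightarrow> \<bar>shift_apply P f j\<bar> \<le> coeff P 0 * D"
      and Qe: "\<And>j. j < n \<Longrightarrow> shift_apply Q e j = f j" and j: "j < n + q"
    \<comment> \<open>The summand 1 makes \<open>X\<close> dominate \<open>D\<close> too, so that
      \<open>X\<close> also bounds the initial values of \<open>e\<close>.\<close>
    define X where "X = (C2 + 1) * (real n + 1) ^ p * D"
    have "1 * 1 \<le> (C2 + 1) * (real n + 1) ^ p" by (rule mult_mono) (use C2 in auto)
    then have DX: "D \<le> X" unfolding X_def using mult_right_mono[of 1 _ D] D by simp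
    have "\<bar>f i\<bar> \<le> C2 * (real n + 1) ^ p * D" if "i < n" for i
      using b2[of D f n] D f Pf p0 that by simp
    moreover have "C2 * (real n + 1) ^ p * D \<le> X"
      unfolding X_def by (intro mult_right_mono) (use D in auto)
    ultimately have "\<bar>f i\<bar> \<le> X" if "i < n" for i using that by (meson order_trans)
    then have "\<bar>e j\<bar> \<le> C1 * (real n + 1) ^ q * X"
      using b1[of X e n] D DX e Qe j by (force intro: order_trans)
    also have "\<dots> = C1 * (C2 + 1) * (real n + 1) ^ (p + q) * D"
      by (simp add: X_def power_add)
    finally show "\<bar>e j\<bar> \<le> C1 * (C2 + 1) * (real n + 1) ^ (p + q) * D" .
  qed
qed

text \<open>Each of the \<open>N ^ n\<close> grid points with coordinates in \<open>1 / N\<close>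
  times the integers is hit, modulo integers, by the image of some \<open>c\<close> in the cube.
  Multiplying by \<open>N\<close> gives an integer output congruent to \<open>u\<close> modulo
  \<open>N\<close>, so distinct grid points have distinct outputs and the encoding bound applies.
  \<open>K\<close> is half the side of the scaled cube.\<close>

lemma covering_count_le:
  fixes P Q :: "real poly"
  defines "p \<equiv> degree P" and "q \<equiv> degree Q"
  assumes leadQ: "lead_coeff Q = 1" and p0: "coeff P 0 > 0" and D: "D > 0" and G: "G \<ge> 0"
    and e: "e > 0" and N: "N > (0::nat)"
    and growth: "\<And>e f j. (\<And>i. i < q \<Longrightarrow> \<bar>e i\<bar> \<le> D) \<Longrightarrow> (\<And>i. i < p \<Longrightarrow> \<bar>f (n + i)\<bar> \<le> D) \<Longrightarrow>
       (\<And>j. j < n \<Longrightarrow> \<bar>shift_apply P f j\<bar> \<le> coeff P 0 * D) \<Longrightarrow>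
       (\<And>j. j < n \<Longrightarrow> shift_apply Q e j = f j) \<Longrightarrow> j < n + q \<Longrightarrow> \<bar>e j\<bar> \<le> G * D"
    and cover: "\<And>y :: nat \<Rightarrow> real. \<exists>c. (\<forall>i<n + p + q. \<bar>c i\<bar> \<le> e / 2) \<and>
       (\<forall>j<n. shift_apply (P * Q) c j - shift_apply (P * Q) y j \<in> \<int>)"
  defines "K \<equiv> real N * e / 2"
  shows "real N ^ n \<le> (2 * K / D + 2) ^ q * (2 * (coeff_norm Q * K) / D + 2) ^ p *
     (2 * (K + G * D) / D + 2) ^ n * (coeff P 0 * D + 1) ^ n"
proof -
  define U where "U = PiE {..<n} (\<lambda>_. {0..<int N})"
  have "P * Q \<noteq> 0" using leadQ p0 by auto
  have "\<exists>c z. (\<forall>i<n + p + q. \<bar>c i\<bar> \<le> e / 2) \<and>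
      (\<forall>j<n. shift_apply (P * Q) c j = of_int (u j) / real N + of_int (z j))" for u :: "nat \<Rightarrow> int"
  proof -
    \<comment> \<open>\<open>cover\<close> speaks only of images of sequences \<open>y\<close>;
      since the map is onto, every grid point is one.\<close>
    obtain y where y: "\<forall>j<n. shift_apply (P * Q) y j = of_int (u j) / real N"
      using forward_solution_exists[OF \<open>P * Q \<noteq> 0\<close>, of _ n "\<lambda>j. of_int (u j) / real N"] by blast
    obtain c where c: "\<forall>i<n + p + q. \<bar>c i\<bar> \<le> e / 2"
      "\<forall>j<n. shift_apply (P * Q) c j - shift_apply (P * Q) y j \<in> \<int>"
      using cover[of y] by blast
    have "\<forall>j<n. shift_apply (P * Q) c j = of_int (u j) / real N +
        of_int \<lfloor>shift_apply (P * Q) c j - shift_apply (P * Q) y j\<rfloor>"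
      using c(2) y by (simp add: of_int_floor)
    then show ?thesis using c(1)
      by (intro exI[of _ c] exI[of _ "\<lambda>j. \<lfloor>shift_apply (P * Q) c j - shift_apply (P * Q) y j\<rfloor>"]) blast
  qed
  then obtain c z where c: "\<And>u i. i < n + p + q \<Longrightarrow> \<bar>c u i\<bar> \<le> e / 2" and
    z: "\<And>u j. j < n \<Longrightarrow> shift_apply (P * Q) (c u) j = of_int (u j) / real N + of_int (z u j :: int)"
    by metis
  have "real (card U) \<le> (2 * K / D + 2) ^ q * (2 * (coeff_norm Q * K) / D + 2) ^ p *
     (2 * (K + G * D) / D + 2) ^ n * (coeff P 0 * D + 1) ^ n"
    unfolding p_def q_def
  proof (rule card_integer_outputs_le[where c = "\<lambda>u i. real N * c u i" and w = "\<lambda>u j. u j + int N * z u j"])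
    show "K > 0" using N e by (simp add: K_def)
    fix u v i j assume u: "u \<in> U"
    show "\<bar>real N * c u i\<bar> \<le> K" if "i < n + degree P + degree Q"
      using c[of i u] that mult_left_mono[of "\<bar>c u i\<bar>" "e / 2" "real N"]
      by (simp add: abs_mult K_def p_def q_def)
    show "real_of_int (u j + int N * z u j) = shift_apply (P * Q) (\<lambda>i. real N * c u i) j" if "j < n"
      unfolding shift_apply_seq_scale z[OF that] distrib_left using N by simp
    show "u = v" if v: "v \<in> U" and eq: "\<And>j. j < n \<Longrightarrow> u j + int N * z u j = v j + int N * z v j"
    proof (rule PiE_ext[OF u[unfolded U_def] v[unfolded U_def]])
      fix j assume "j \<in> {..<n}"
      then have j: "j < n" by simp
      have "u j mod int N = (u j + int N * z u j) mod int N" by simp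
      also have "\<dots> = v j mod int N" unfolding eq[OF j] by simp
      finally show "u j = v j"
        using PiE_mem[OF u[unfolded U_def], of j] PiE_mem[OF v[unfolded U_def], of j] j by simp
    qed
  qed (use leadQ p0 D G growth[unfolded p_def q_def] in blast)+
  moreover have "card U = N ^ n" by (simp add: U_def card_PiE)
  ultimately show ?thesis by simp
qed

section \<open>Asymptotics as the dimension grows\<close>

lemma polynomial_times_geometric_tendsto_0:
  fixes x :: real
  assumes "0 < x" "x < 1"
  shows "(\<lambda>n. (real n + 1) ^ k * x ^ n) \<longlonglongrightarrow> 0"
proof -
  \<comment> \<open>The majorant is the power \<open>Suc k\<close> of
    \<open>(n + 1) * y ^ n\<close>; using \<open>Suc k\<close> instead of \<open>k\<close> avoids a
    zeroth root.\<close>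
  define y where "y = root (Suc k) x"
  have y: "0 < y" "y < 1" "y ^ Suc k = x"
    using assms real_root_pow_pos2[of "Suc k" x] by (simp_all add: y_def del: power_Suc)
  have "(\<lambda>n. real n * y ^ n + y ^ n) \<longlonglongrightarrow> 0 + 0"
    by (intro tendsto_add LIMSEQ_power_zero)
      (use y powser_times_n_limit_0[of y] in simp_all)
  then have "(\<lambda>n. (real n * y ^ n + y ^ n) ^ Suc k) \<longlonglongrightarrow> 0 ^ Suc k"
    by (intro tendsto_power) simp
  moreover have "(real n * y ^ n + y ^ n) ^ Suc k = (real n + 1) ^ Suc k * x ^ n" for n
  proof -
    have "real n * y ^ n + y ^ n = (real n + 1) * y ^ n" by (simp add: algebra_simps)
    then show ?thesis by (simp only: power_mult_distrib power_mult[symmetric] y(3)[symmetric] mult.commute)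
  qed
  ultimately have lim: "(\<lambda>n. (real n + 1) ^ Suc k * x ^ n) \<longlonglongrightarrow> 0" by simp
  show ?thesis
  proof (rule tendsto_sandwich[OF _ _ tendsto_const lim])
    show "\<forall>\<^sub>F n in sequentially. (real n + 1) ^ k * x ^ n \<le> (real n + 1) ^ Suc k * x ^ n"
      using assms by (intro always_eventually allI mult_right_mono power_increasing) auto
  qed (use assms in simp)
qed

text \<open>\<open>B\<close> and \<open>k\<close> are uniform in \<open>n\<close>, while
  \<open>N\<close> and \<open>D\<close> are chosen for each \<open>n\<close>. Excess cells and
  excess rounding errors each cost a factor \<open>1 + \<eta>\<close> per coordinate, whence the
  square; the rest is polynomial in \<open>n\<close>.\<close>

lemma covering_inequality:
  fixes P Q :: "real poly"
  defines "p \<equiv> degree P" and "q \<equiv> degree Q"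
  assumes leadQ: "lead_coeff Q = 1" and p0: "coeff P 0 > 0"
    and gQ: "polynomial_growth Q" and gP: "polynomial_growth (smult (1 / coeff P 0) (reflect_poly P))"
    and e: "e > 0" and \<eta>: "\<eta> > 0"
  shows "\<exists>B k. \<forall>n. (\<forall>y :: nat \<Rightarrow> real. \<exists>c. (\<forall>i<n + p + q. \<bar>c i\<bar> \<le> e / 2) \<and>
       (\<forall>j<n. shift_apply (P * Q) c j - shift_apply (P * Q) y j \<in> \<int>)) \<longrightarrow>
       1 \<le> B * (real n + 1) ^ k * (e * coeff P 0 * (1 + \<eta>)\<^sup>2) ^ n"
proof -
  from combined_growth[OF gQ gP p0] obtain C where C: "C \<ge> 0" and
    growth: "\<And>n D e f j. D > 0 \<Longrightarrow> (\<And>i. i < q \<Longrightarrow> \<bar>e i\<bar> \<le> D) \<Longrightarrow>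
       (\<And>i. i < p \<Longrightarrow> \<bar>f (n + i)\<bar> \<le> D) \<Longrightarrow>
       (\<And>j. j < n \<Longrightarrow> \<bar>shift_apply P f j\<bar> \<le> coeff P 0 * D) \<Longrightarrow>
       (\<And>j. j < n \<Longrightarrow> shift_apply Q e j = f j) \<Longrightarrow> j < n + q \<Longrightarrow>
       \<bar>e j\<bar> \<le> (C * (real n + 1) ^ (p + q)) * D"
    unfolding p_def q_def by metis
  define S where "S = coeff_norm Q"
  have S: "S \<ge> 0" by (simp add: S_def coeff_norm_nonneg)
  \<comment> \<open>Chosen for \<open>GH\<close>: the ratio \<open>K / D = H = c * L\<close> must be
    at least \<open>(G + 1) / \<eta>\<close>, where \<open>G = C * L\<close> and
    \<open>L \<ge> 1\<close>.\<close>
  define c where "c = (C + 1) / \<eta>"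
  have c: "c > 0" using C \<eta> by (simp add: c_def)
  define d where "d = p + q"
  define B where "B = (2 * c + 2) ^ q * (2 * S * c + 2) ^ p"
  have "1 \<le> B * (real n + 1) ^ (d * d) * (e * coeff P 0 * (1 + \<eta>)\<^sup>2) ^ n"
    if cover: "\<And>y :: nat \<Rightarrow> real. \<exists>c. (\<forall>i<n + p + q. \<bar>c i\<bar> \<le> e / 2) \<and>
       (\<forall>j<n. shift_apply (P * Q) c j - shift_apply (P * Q) y j \<in> \<int>)" for n
  proof -
    define L where "L = (real n + 1) ^ d"
    have L: "L \<ge> 1" by (simp add: L_def)
    define G where "G = C * L"
    define H where "H = c * L"
    have H: "H > 0" using c L by (simp add: H_def)
    have GH: "2 * G + 2 \<le> 2 * \<eta> * H"
      using L C \<eta> by (simp add: G_def H_def c_def algebra_simps)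
    \<comment> \<open>\<open>N\<close> is so large that
      \<open>coeff P 0 * D \<ge> 1 / \<eta>\<close>; the additional 1 in the number of rounding
      errors is then relatively small.\<close>
    obtain N :: nat where N: "real N > 2 * H / (e * coeff P 0 * \<eta>)"
      using reals_Archimedean2 by blast
    have "2 * H / (e * coeff P 0 * \<eta>) > 0" using H e p0 \<eta> by simp
    then have N0: "real N > 0" using N by linarith
    define K where "K = real N * e / 2"
    define D where "D = K / H"
    have K: "K > 0" using N0 e by (simp add: K_def)
    have D: "D > 0" using K H by (simp add: D_def)
    have KD: "K / D = H" using K H by (simp add: D_def)
    have "2 * H < real N * (e * coeff P 0 * \<eta>)" using N e p0 \<eta> by (simp add: divide_less_eq)
    then have D_large: "1 \<le> \<eta> * (coeff P 0 * D)"
      using H by (simp add: D_def K_def field_simps)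
    have "real N ^ n \<le> (2 * K / D + 2) ^ q * (2 * (S * K) / D + 2) ^ p *
       (2 * (K + G * D) / D + 2) ^ n * (coeff P 0 * D + 1) ^ n"
      unfolding K_def S_def p_def q_def
    proof (rule covering_count_le[OF leadQ p0 D _ e])
      show "G \<ge> 0" using C L by (simp add: G_def)
      show "N > 0" using N0 by simp
      show "\<exists>c. (\<forall>i<n + degree P + degree Q. \<bar>c i\<bar> \<le> e / 2) \<and>
          (\<forall>j<n. shift_apply (P * Q) c j - shift_apply (P * Q) y j \<in> \<int>)" for y
        using cover[of y] unfolding p_def q_def .
      show "\<bar>h j\<bar> \<le> G * D" if "\<And>i. i < degree Q \<Longrightarrow> \<bar>h i\<bar> \<le> D"
        "\<And>i. i < degree P \<Longrightarrow> \<bar>f (n + i)\<bar> \<le> D"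
        "\<And>j. j < n \<Longrightarrow> \<bar>shift_apply P f j\<bar> \<le> coeff P 0 * D"
        "\<And>j. j < n \<Longrightarrow> shift_apply Q h j = f j" "j < n + degree Q" for h f j
        unfolding G_def L_def d_def by (rule growth[OF D]) (use that in \<open>simp_all add: p_def q_def\<close>)
    qed
    also have "\<dots> = (2 * H + 2) ^ q * (2 * S * H + 2) ^ p * (2 * H + 2 * G + 2) ^ n * (coeff P 0 * D + 1) ^ n"
    proof -
      have "2 * K / D = 2 * H" "2 * (S * K) / D = 2 * S * H"
        using KD by (simp_all flip: times_divide_eq_right)
      moreover have "2 * (K + G * D) / D = 2 * H + 2 * G"
        using KD D by (simp add: field_simps)
      ultimately show ?thesis by simp
    qed
    also have "\<dots> \<le> ((2 * c + 2) * L) ^ q * ((2 * S * c + 2) * L) ^ p *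
        (2 * H * (1 + \<eta>)) ^ n * (coeff P 0 * D * (1 + \<eta>)) ^ n"
    proof -
      have "2 * H + 2 \<le> (2 * c + 2) * L" "2 * S * H + 2 \<le> (2 * S * c + 2) * L"
        using L by (simp_all add: H_def algebra_simps)
      moreover have "2 * H + 2 * G + 2 \<le> 2 * H * (1 + \<eta>)" using GH by (simp add: algebra_simps)
      moreover have "coeff P 0 * D + 1 \<le> coeff P 0 * D * (1 + \<eta>)"
        using D_large by (simp add: algebra_simps)
      moreover have "G \<ge> 0" using C L by (simp add: G_def)
      ultimately show ?thesis using H S c L p0 D \<eta>
        by (intro mult_mono power_mono mult_nonneg_nonneg zero_le_power add_nonneg_nonneg) simp_all
    qed
    also have "\<dots> = B * L ^ d * (2 * H * (1 + \<eta>) * (coeff P 0 * D * (1 + \<eta>))) ^ n"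
      unfolding power_mult_distrib B_def d_def power_add by (simp add: mult_ac)
    \<comment> \<open>The mesh cancels: \<open>2 * H * D = 2 * K = N * e\<close>.\<close>
    also have "2 * H * (1 + \<eta>) * (coeff P 0 * D * (1 + \<eta>)) = real N * (e * coeff P 0 * (1 + \<eta>)\<^sup>2)"
      using H by (simp add: D_def K_def power2_eq_square)
    finally have "real N ^ n * 1 \<le> real N ^ n * (B * L ^ d * (e * coeff P 0 * (1 + \<eta>)\<^sup>2) ^ n)"
      unfolding power_mult_distrib by (simp add: mult_ac)
    then show ?thesis
      using N0 by (subst (asm) mult_le_cancel_left_pos) (simp_all add: L_def power_mult)
  qed
  then show ?thesis by blast
qed

subsection \<open>The line in the torus\<close>

text \<open>Apply the Toeplitz map of \<open>A\<close> to the integer vector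
  \<open>t * \<theta> + c - y\<close>: the recurrence kills the part from the line, and integer
  coefficients preserve integrality.\<close>

lemma torus_cover_line_imp:
  fixes A :: "int poly"
  assumes rec: "\<forall>j\<ge>1. (\<Sum>i=0..degree A. of_int (coeff A i) * \<theta> (j + i)) = 0"
    and cov: "torus_cover (n + degree A) (line_lifts \<theta>) e"
  shows "\<exists>c. (\<forall>i<n + degree A. \<bar>c i\<bar> \<le> e / 2) \<and>
    (\<forall>j<n. shift_apply (map_poly real_of_int A) c j - shift_apply (map_poly real_of_int A) y j \<in> \<int>)"
proof -
  define d where "d = degree A"
  let ?A = "map_poly real_of_int A"
  have A: "shift_apply ?A f j = (\<Sum>i\<le>d. of_int (coeff A i) * f (j + i))" for f j
    unfolding d_def by (subst shift_apply_degree_le[of _ "degree A"]) (simp_all add: coeff_map_poly)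
  \<comment> \<open>Torus coordinates start at 1 and sequences at 0, so coordinate \<open>i\<close>
    carries entry \<open>i - 1\<close>.\<close>
  from cov[unfolded torus_cover_def, rule_format, of "\<lambda>i. y (i - 1)"]
  obtain t c where c: "\<forall>i\<in>{1..n + d}. - e / 2 \<le> c i \<and> c i \<le> e / 2"
    and eq: "\<forall>i\<in>{1..n + d}. t * \<theta> i + c i - y (i - 1) \<in> \<int>"
    unfolding line_lifts_def torus_eq_def d_def by auto
  have "shift_apply ?A (\<lambda>i. c (Suc i)) j - shift_apply ?A y j \<in> \<int>" if j: "j < n" for j
  proof -
    have "shift_apply ?A (\<lambda>i. \<theta> (Suc i)) j = 0"
      using rec[rule_format, of "Suc j"] unfolding A by (simp add: d_def atLeast0AtMost)
    then have "shift_apply ?A (\<lambda>i. t * \<theta> (Suc i)) j = 0"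
      unfolding shift_apply_seq_scale by simp
    then have "shift_apply ?A (\<lambda>i. c (Suc i)) j - shift_apply ?A y j =
        shift_apply ?A (\<lambda>i. t * \<theta> (Suc i)) j + shift_apply ?A (\<lambda>i. c (Suc i)) j - shift_apply ?A y j"
      by simp
    also have "\<dots> = (\<Sum>i\<le>d. of_int (coeff A i) * (t * \<theta> (Suc (j + i)) + c (Suc (j + i)) - y (j + i)))"
      unfolding A by (simp add: algebra_simps sum.distrib sum_subtractf)
    also have "\<dots> \<in> \<int>"
    proof (intro Ints_sum Ints_mult Ints_of_int)
      fix i assume "i \<in> {..d}"
      then show "t * \<theta> (Suc (j + i)) + c (Suc (j + i)) - y (j + i) \<in> \<int>"
        using eq[rule_format, of "Suc (j + i)"] j by simp
    qed
    finally show ?thesis .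
  qed
  moreover have "\<forall>i<n + d. \<bar>c (Suc i)\<bar> \<le> e / 2" 
  proof (intro allI impI)
    fix i assume "i < n + d"
    then have "- e / 2 \<le> c (Suc i) \<and> c (Suc i) \<le> e / 2" using c[rule_format, of "Suc i"] by simp
    then show "\<bar>c (Suc i)\<bar> \<le> e / 2" by linarith
  qed
  ultimately show ?thesis unfolding d_def by (intro exI[of _ "\<lambda>i. c (Suc i)"]) blast
qed

theorem theorem2:
  fixes A :: "int poly" and \<theta> :: "nat \<Rightarrow> real" and d :: nat
  assumes "d > 0"
    and "degree A = d"
    and "content A = 1"
    and "coeff A 0 \<noteq> 0"
    and "\<forall>q :: nat \<Rightarrow> rat. (\<Sum>i=1..d. of_rat (q i) * \<theta> i) = 0 \<longrightarrow> (\<forall>i\<in>{1..d}. q i = 0)"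
    and "\<forall>j\<ge>1. (\<Sum>i=0..d. of_int (coeff A i) * \<theta> (j + i)) = 0"
  shows "\<forall>\<epsilon>::real. \<epsilon> < 1 / mahler_measure A \<longrightarrow>
           (\<exists>m0. \<forall>m\<ge>m0. \<not> torus_eps_dense m (line_lifts \<theta>) \<epsilon>)"
proof (intro allI impI)
  fix \<epsilon> :: real
  assume eps: "\<epsilon> < 1 / mahler_measure A"
  have "A \<noteq> 0" using assms(4) by auto
  then obtain P' Q where fact: "map_poly real_of_int A = P' * Q" and Q: "lead_coeff Q = 1"
    "polynomial_growth Q" and P': "polynomial_growth (smult (1 / coeff P' 0) (reflect_poly P'))"
    "\<bar>coeff P' 0\<bar> = mahler_measure A" "coeff P' 0 \<noteq> 0"
    by (rule mahler_factorization)
  \<comment> \<open>The count needs \<open>coeff P 0 > 0\<close>; moving the sign into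
    \<open>P\<close> only replaces \<open>A\<close> by its negative, if at all.\<close>
  define s where "s = sgn (coeff P' 0)"
  define P where "P = smult s P'"
  have s: "s = 1 \<or> s = - 1" using P'(3) by (auto simp: s_def sgn_if)
  have P0: "coeff P 0 = mahler_measure A" "coeff P 0 > 0"
    using P' by (auto simp: P_def s_def sgn_if)
  have gP: "polynomial_growth (smult (1 / coeff P 0) (reflect_poly P))"
    using P'(1) s by (auto simp: P_def reflect_poly_smult)
  have PQ: "P * Q = smult s (map_poly real_of_int A)" by (simp add: P_def fact)
  have "degree (P * Q) = d" using s assms(2) unfolding PQ by auto
  moreover have "P \<noteq> 0" "Q \<noteq> 0" using P0 Q(1) by auto
  ultimately have deg: "degree P + degree Q = d" by (simp add: degree_mult_eq)
  \<comment> \<open>The maximum with 0 keeps the side of the cube positive when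
    \<open>\<epsilon>\<close> is not; \<open>e > \<epsilon>\<close> turns density into a
    covering.\<close>
  obtain e where e: "max 0 \<epsilon> < e" "e < 1 / coeff P 0"
    using dense[of "max 0 \<epsilon>" "1 / coeff P 0"] eps P0 by auto
  have e0: "e > 0" and \<epsilon>e: "e > \<epsilon>" using e(1) by auto
  have eP: "0 < e * coeff P 0" "e * coeff P 0 < 1" using e0 e(2) P0(2) by (simp_all add: field_simps)
  \<comment> \<open>\<open>x\<close> plays the role of \<open>1 + \<eta>\<close>, with
    \<open>\<eta>\<close> so small that the base of the geometric factor stays below 1.\<close>
  obtain x where x: "1 < x" "x < sqrt (1 / (e * coeff P 0))"
    using dense[of 1 "sqrt (1 / (e * coeff P 0))"] eP by auto
  have "x\<^sup>2 < (sqrt (1 / (e * coeff P 0)))\<^sup>2" using x by (intro power_strict_mono) auto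
  then have "x\<^sup>2 < 1 / (e * coeff P 0)" using eP by simp
  then have r1: "e * coeff P 0 * x\<^sup>2 < 1" using eP by (simp add: field_simps)
  have r0: "0 < e * coeff P 0 * x\<^sup>2" using eP x by simp
  have "x - 1 > 0" and x_eq: "1 + (x - 1) = x" using x by simp_all
  from covering_inequality[OF Q(1) P0(2) Q(2) gP e0 \<open>x - 1 > 0\<close>, unfolded x_eq]
  obtain B k where B: "\<And>n. (\<forall>y :: nat \<Rightarrow> real. \<exists>c. (\<forall>i<n + degree P + degree Q. \<bar>c i\<bar> \<le> e / 2) \<and>
       (\<forall>j<n. shift_apply (P * Q) c j - shift_apply (P * Q) y j \<in> \<int>)) \<Longrightarrow>
       1 \<le> B * (real n + 1) ^ k * (e * coeff P 0 * x\<^sup>2) ^ n"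
    by blast
  have "(\<lambda>n. B * ((real n + 1) ^ k * (e * coeff P 0 * x\<^sup>2) ^ n)) \<longlonglongrightarrow> B * 0"
    by (intro tendsto_mult tendsto_const polynomial_times_geometric_tendsto_0 r0 r1)
  then have "\<forall>\<^sub>F n in sequentially. B * ((real n + 1) ^ k * (e * coeff P 0 * x\<^sup>2) ^ n) < 1"
    by (rule order_tendstoD(2)) simp
  then obtain n0 where n0: "\<And>n. n \<ge> n0 \<Longrightarrow> B * ((real n + 1) ^ k * (e * coeff P 0 * x\<^sup>2) ^ n) < 1"
    unfolding eventually_sequentially by blast
  \<comment> \<open>The offset \<open>d\<close> appears because \<open>m\<close> coordinates yield
    only \<open>m - d\<close> outputs.\<close>
  have "\<not> torus_eps_dense m (line_lifts \<theta>) \<epsilon>" if m: "m \<ge> n0 + d" for m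
  proof
    assume "torus_eps_dense m (line_lifts \<theta>) \<epsilon>"
    then have "torus_cover m (line_lifts \<theta>) e" using \<epsilon>e by (simp add: torus_eps_dense_def)
    moreover define n where "n = m - d"
    ultimately have cov: "torus_cover (n + degree A) (line_lifts \<theta>) e" using m assms(2) by simp
    have "1 \<le> B * (real n + 1) ^ k * (e * coeff P 0 * x\<^sup>2) ^ n"
    proof (rule B, rule allI)
      fix y :: "nat \<Rightarrow> real"
      obtain c where c: "\<forall>i<n + d. \<bar>c i\<bar> \<le> e / 2" "\<forall>j<n. shift_apply (map_poly real_of_int A) c j -
          shift_apply (map_poly real_of_int A) y j \<in> \<int>"
        using torus_cover_line_imp[OF _ cov, of y] assms(2,6) by auto
      have "\<forall>j<n. shift_apply (P * Q) c j - shift_apply (P * Q) y j \<in> \<int>"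
        using c(2) s unfolding PQ shift_apply_smult right_diff_distrib[symmetric]
        by (auto simp: minus_in_Ints_iff simp del: minus_diff_eq)
      then show "\<exists>c. (\<forall>i<n + degree P + degree Q. \<bar>c i\<bar> \<le> e / 2) \<and>
          (\<forall>j<n. shift_apply (P * Q) c j - shift_apply (P * Q) y j \<in> \<int>)"
        using c(1) deg by (intro exI[of _ c]) (simp add: add.assoc)
    qed
    moreover have "n \<ge> n0" using m by (simp add: n_def)
    ultimately show False using n0[of n] by (simp add: mult.assoc)
  qed
  then show "\<exists>m0. \<forall>m\<ge>m0. \<not> torus_eps_dense m (line_lifts \<theta>) \<epsilon>" by blast
qed

end
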